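(* Let $\Theta$ be a hereditary variety of algebras, with fixed free algebras $F^0=F(X^0)$, $X^0=\{x_1,\dots,x_k\}$, such that $\Theta=\mathrm{Var}(F^0)$, and $F_0=F(x_0)$ (free on one generator). Let $\nu_0:F^0\to F_0$ be the morphism with $\nu_0(x)=x_0$ for every $x\in X^0$. Let $\varphi$ be an automorphism of the category $\Theta^0$ which does not change objects, which induces the identity automorphism on the semigroup $\mathrm{End}(F^0)$, and for which $\varphi(\nu_0)=\nu_0$. Then $\varphi$ is an inner automorphism of $\Theta^0$.
   Context: For a variety of algebras $\Theta$, $\Theta^0$ denotes the category whose objects are the free algebras $F(X)$ of $\Theta$ with $X$ a finite subset of a fixed infinite universal set of variables, and whose morphisms are all homomorphisms. An automorphism of a category is an invertible functor from the category to itself; it does not change objects if $\varphi(F)=F$ for every object $F$. An automorphism $\varphi$ of a category $\mathcal C$ is inner if for every object $A$ there is an isomorphism $s_A:A\to\varphi(A)$ such that $\varphi(\nu)=s_B\nu s_A^{-1}$ for every morphism $\nu:A\to B$. $\mathrm{Var}(H)$ is the variety generated by $H$. The variety $\Theta$ is called hereditary if: (1) $\Theta$ is hopfian, i.e. for every object $F$ of $\Theta^0$ every surjective endomorphism $F\to F$ is an automorphism; (2) for the cyclic free algebra $F_0=F(x_0)$ and every automorphism $\varphi$ of $\Theta^0$, $\varphi(F_0)$ is also a cyclic free algebra $F(y_0)$; (3) there exists a finitely generated free algebra $F^0=F(X^0)$, $X^0=\{x_1,\dots,x_k\}$, with $\Theta=\mathrm{Var}(F^0)$. *)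

theory Defs
  imports Main "HOL-Library.FuncSet"
begin

section \<open>Algebras\<close>

text \<open>The operation symbols form a set, so that the empty signature is included.\<close>

record 'f signature =
  symbols :: "'f set"
  arity :: "'f \<Rightarrow> nat"

record ('f, 'a) algebra =
  carrier :: "'a set"
  op :: "'f \<Rightarrow> 'a list \<Rightarrow> 'a"

text \<open>Carriers may be empty, so that the free algebra over the empty set exists also when there
  are no constants.\<close>

definition is_algebra :: "'f signature \<Rightarrow> ('f, 'a) algebra \<Rightarrow> bool" where
  "is_algebra \<Sigma> A \<longleftrightarrow>
    (\<forall>f\<in>symbols \<Sigma>. \<forall>as\<in>lists (carrier A). length as = arity \<Sigma> f \<longrightarrow> op A f as \<in> carrier A)"

definition homs :: "'f signature \<Rightarrow> ('f, 'a) algebra \<Rightarrow> ('f, 'b) algebra \<Rightarrow> ('a \<Rightarrow> 'b) set" where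
  "homs \<Sigma> A B = {h \<in> carrier A \<rightarrow>\<^sub>E carrier B.
    \<forall>f\<in>symbols \<Sigma>. \<forall>as\<in>lists (carrier A). length as = arity \<Sigma> f \<longrightarrow>
      h (op A f as) = op B f (map h as)}"

definition is_congruence :: "'f signature \<Rightarrow> ('f, 'a) algebra \<Rightarrow> 'a rel \<Rightarrow> bool" where
  "is_congruence \<Sigma> A \<theta> \<longleftrightarrow> equiv (carrier A) \<theta> \<and>
    (\<forall>f\<in>symbols \<Sigma>. \<forall>as bs. length as = arity \<Sigma> f \<longrightarrow> list_all2 (\<lambda>a b. (a, b) \<in> \<theta>) as bs \<longrightarrow>
      (op A f as, op A f bs) \<in> \<theta>)"

text \<open>For a congruence, the image below is the class of \<open>op A f as\<close> for any choice of
  representatives \<open>as\<close> of the classes \<open>Cs\<close>.\<close>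

definition quotient_algebra :: "('f, 'a) algebra \<Rightarrow> 'a rel \<Rightarrow> ('f, 'a set) algebra" where
  "quotient_algebra A \<theta> =
    \<lparr>carrier = carrier A // \<theta>,
     op = (\<lambda>f Cs. \<theta> `` {op A f as |as. list_all2 (\<in>) as Cs})\<rparr>"


section \<open>Terms, identities and varieties\<close>

datatype ('f, 'v) trm = Var 'v | App 'f "('f, 'v) trm list"

inductive_set terms :: "'f signature \<Rightarrow> 'v set \<Rightarrow> ('f, 'v) trm set"
  for \<Sigma> :: "'f signature" and X :: "'v set" where
  "x \<in> X \<Longrightarrow> Var x \<in> terms \<Sigma> X"
| "f \<in> symbols \<Sigma> \<Longrightarrow> length ts = arity \<Sigma> f \<Longrightarrow> (\<forall>t\<in>set ts. t \<in> terms \<Sigma> X) \<Longrightarrow> App f ts \<in> terms \<Sigma> X"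

definition term_algebra :: "'f signature \<Rightarrow> 'v set \<Rightarrow> ('f, ('f, 'v) trm) algebra" where
  "term_algebra \<Sigma> X = \<lparr>carrier = terms \<Sigma> X, op = App\<rparr>"

primrec eval_trm :: "('f, 'a) algebra \<Rightarrow> ('v \<Rightarrow> 'a) \<Rightarrow> ('f, 'v) trm \<Rightarrow> 'a" where
  "eval_trm A \<rho> (Var x) = \<rho> x"
| "eval_trm A \<rho> (App f ts) = op A f (map (eval_trm A \<rho>) ts)"

definition satisfies :: "('f, 'a) algebra \<Rightarrow> ('f, 'v) trm \<Rightarrow> ('f, 'v) trm \<Rightarrow> bool" where
  "satisfies A s t \<longleftrightarrow> (\<forall>\<rho>\<in>UNIV \<rightarrow> carrier A. eval_trm A \<rho> s = eval_trm A \<rho> t)"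

text \<open>A class of algebras is a set of algebras whose carriers are subsets of one type, and that type
  is taken to consist of the sets of terms over the variables \<open>'v\<close>. When \<open>'v\<close> is infinite, the free
  algebra over all of \<open>'v\<close> of every equational class is such an algebra, so that a variety is
  determined by its members with carrier in this type.\<close>

type_synonym ('f, 'v) alg = "('f, ('f, 'v) trm set) algebra"

definition is_variety :: "'f signature \<Rightarrow> ('f, 'v) alg set \<Rightarrow> bool" where
  "is_variety \<Sigma> \<Theta> \<longleftrightarrow>
    (\<exists>E \<subseteq> terms \<Sigma> (UNIV :: 'v set) \<times> terms \<Sigma> UNIV.
      \<Theta> = {A. is_algebra \<Sigma> A \<and> (\<forall>(s, t)\<in>E. satisfies A s t)})"

definition generated_variety :: "'f signature \<Rightarrow> ('f, 'v) alg \<Rightarrow> ('f, 'v) alg set" where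
  "generated_variety \<Sigma> H = \<Inter> {\<Theta>. is_variety \<Sigma> \<Theta> \<and> H \<in> \<Theta>}"


section \<open>Free algebras\<close>

text \<open>\<open>F(X)\<close> is the quotient of the algebra of terms over \<open>X\<close> by its least congruence with quotient in
  \<open>\<Theta>\<close>. The classes contain terms over \<open>X\<close> only, so distinct sets \<open>X\<close> give distinct objects \<open>F(X)\<close>,
  even in the trivial variety.\<close>

definition free_congruence ::
    "'f signature \<Rightarrow> ('f, 'v) alg set \<Rightarrow> 'v set \<Rightarrow> ('f, 'v) trm rel" where
  "free_congruence \<Sigma> \<Theta> X =
    \<Inter> {\<theta>. is_congruence \<Sigma> (term_algebra \<Sigma> X) \<theta> \<and> quotient_algebra (term_algebra \<Sigma> X) \<theta> \<in> \<Theta>}"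

definition free_algebra :: "'f signature \<Rightarrow> ('f, 'v) alg set \<Rightarrow> 'v set \<Rightarrow> ('f, 'v) alg" where
  "free_algebra \<Sigma> \<Theta> X = quotient_algebra (term_algebra \<Sigma> X) (free_congruence \<Sigma> \<Theta> X)"

text \<open>The generator of \<open>F(X)\<close> given by the variable \<open>x \<in> X\<close>.\<close>

definition generator ::
    "'f signature \<Rightarrow> ('f, 'v) alg set \<Rightarrow> 'v set \<Rightarrow> 'v \<Rightarrow> ('f, 'v) trm set" where
  "generator \<Sigma> \<Theta> X x = free_congruence \<Sigma> \<Theta> X `` {Var x}"


section \<open>Categories and their automorphisms\<close>

record ('o, 'm) category =
  Obj :: "'o set"
  Hom :: "'o \<Rightarrow> 'o \<Rightarrow> 'm set"
  Id :: "'o \<Rightarrow> 'm"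
  Comp :: "'o \<Rightarrow> 'o \<Rightarrow> 'o \<Rightarrow> 'm \<Rightarrow> 'm \<Rightarrow> 'm"

text \<open>\<open>Comp C A B D g f\<close> is the composite of \<open>f : A \<rightarrow> B\<close> followed by \<open>g : B \<rightarrow> D\<close>.\<close>

record ('o, 'm) endofunctor =
  obj_map :: "'o \<Rightarrow> 'o"
  arr_map :: "'o \<Rightarrow> 'o \<Rightarrow> 'm \<Rightarrow> 'm"

definition is_endofunctor :: "('o, 'm) category \<Rightarrow> ('o, 'm) endofunctor \<Rightarrow> bool" where
  "is_endofunctor C \<phi> \<longleftrightarrow>
    (\<forall>A\<in>Obj C. obj_map \<phi> A \<in> Obj C) \<and>
    (\<forall>A\<in>Obj C. \<forall>B\<in>Obj C. \<forall>f\<in>Hom C A B.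
      arr_map \<phi> A B f \<in> Hom C (obj_map \<phi> A) (obj_map \<phi> B)) \<and>
    (\<forall>A\<in>Obj C. arr_map \<phi> A A (Id C A) = Id C (obj_map \<phi> A)) \<and>
    (\<forall>A\<in>Obj C. \<forall>B\<in>Obj C. \<forall>D\<in>Obj C. \<forall>f\<in>Hom C A B. \<forall>g\<in>Hom C B D.
      arr_map \<phi> A D (Comp C A B D g f) =
        Comp C (obj_map \<phi> A) (obj_map \<phi> B) (obj_map \<phi> D) (arr_map \<phi> B D g) (arr_map \<phi> A B f))"

definition left_inverse_functor ::
    "('o, 'm) category \<Rightarrow> ('o, 'm) endofunctor \<Rightarrow> ('o, 'm) endofunctor \<Rightarrow> bool" where
  "left_inverse_functor C \<psi> \<phi> \<longleftrightarrow>
    (\<forall>A\<in>Obj C. obj_map \<psi> (obj_map \<phi> A) = A) \<and>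
    (\<forall>A\<in>Obj C. \<forall>B\<in>Obj C. \<forall>f\<in>Hom C A B.
      arr_map \<psi> (obj_map \<phi> A) (obj_map \<phi> B) (arr_map \<phi> A B f) = f)"

definition is_automorphism :: "('o, 'm) category \<Rightarrow> ('o, 'm) endofunctor \<Rightarrow> bool" where
  "is_automorphism C \<phi> \<longleftrightarrow> is_endofunctor C \<phi> \<and>
    (\<exists>\<psi>. is_endofunctor C \<psi> \<and> left_inverse_functor C \<psi> \<phi> \<and> left_inverse_functor C \<phi> \<psi>)"

definition inverse_arrows :: "('o, 'm) category \<Rightarrow> 'o \<Rightarrow> 'o \<Rightarrow> 'm \<Rightarrow> 'm \<Rightarrow> bool" where
  "inverse_arrows C A B s t \<longleftrightarrow> s \<in> Hom C A B \<and> t \<in> Hom C B A \<and>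
    Comp C A B A t s = Id C A \<and> Comp C B A B s t = Id C B"

definition is_isomorphism :: "('o, 'm) category \<Rightarrow> 'o \<Rightarrow> 'o \<Rightarrow> 'm \<Rightarrow> bool" where
  "is_isomorphism C A B s \<longleftrightarrow> (\<exists>t. inverse_arrows C A B s t)"

text \<open>In the following definition \<open>t A\<close> is the inverse of \<open>s A\<close>.\<close>

definition is_inner_automorphism :: "('o, 'm) category \<Rightarrow> ('o, 'm) endofunctor \<Rightarrow> bool" where
  "is_inner_automorphism C \<phi> \<longleftrightarrow> is_automorphism C \<phi> \<and>
    (\<exists>s t. (\<forall>A\<in>Obj C. inverse_arrows C A (obj_map \<phi> A) (s A) (t A)) \<and>
      (\<forall>A\<in>Obj C. \<forall>B\<in>Obj C. \<forall>\<nu>\<in>Hom C A B.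
        arr_map \<phi> A B \<nu> =
          Comp C (obj_map \<phi> A) B (obj_map \<phi> B) (s B) (Comp C (obj_map \<phi> A) A B \<nu> (t A))))"


section \<open>The category of free algebras and hereditary varieties\<close>

definition free_category ::
    "'f signature \<Rightarrow> ('f, 'v) alg set \<Rightarrow>
      (('f, 'v) alg, ('f, 'v) trm set \<Rightarrow> ('f, 'v) trm set) category" where
  "free_category \<Sigma> \<Theta> =
    \<lparr>Obj = {free_algebra \<Sigma> \<Theta> X |X. finite X},
     Hom = homs \<Sigma>,
     Id = (\<lambda>A. restrict id (carrier A)),
     Comp = (\<lambda>A B D g f. compose (carrier A) g f)\<rparr>"

definition is_hopfian :: "'f signature \<Rightarrow> ('f, 'v) alg set \<Rightarrow> bool" where
  "is_hopfian \<Sigma> \<Theta> \<longleftrightarrow>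
    (\<forall>F\<in>Obj (free_category \<Sigma> \<Theta>). \<forall>\<mu>\<in>homs \<Sigma> F F.
      \<mu> ` carrier F = carrier F \<longrightarrow> is_isomorphism (free_category \<Sigma> \<Theta>) F F \<mu>)"

definition is_hereditary :: "'f signature \<Rightarrow> ('f, 'v) alg set \<Rightarrow> 'v \<Rightarrow> bool" where
  "is_hereditary \<Sigma> \<Theta> x\<^sub>0 \<longleftrightarrow> is_variety \<Sigma> \<Theta> \<and>
    is_hopfian \<Sigma> \<Theta> \<and>
    (\<forall>\<phi>. is_automorphism (free_category \<Sigma> \<Theta>) \<phi> \<longrightarrow>
      (\<exists>y\<^sub>0. obj_map \<phi> (free_algebra \<Sigma> \<Theta> {x\<^sub>0}) = free_algebra \<Sigma> \<Theta> {y\<^sub>0})) \<and>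
    (\<exists>X. finite X \<and> X \<noteq> {} \<and> \<Theta> = generated_variety \<Sigma> (free_algebra \<Sigma> \<Theta> X))"

end

theory Submission imports Defs begin

text \<open>Write \<open>F\<^sup>0 = F(X\<^sub>0)\<close>. Evaluation at \<open>x\<^sub>0\<close> identifies \<open>Hom(F(x\<^sub>0), A)\<close> with the set \<open>A\<close>, so the
  bijections that \<open>\<phi>\<close> induces on these sets of morphisms become bijections
  \<open>s\<^sub>A : A \<rightarrow> A\<close>, \<open>\<nu>(x\<^sub>0) \<mapsto> \<phi>(\<nu>)(x\<^sub>0)\<close>, and functoriality gives \<open>\<phi>(\<mu>) s\<^sub>A = s\<^sub>B \<mu>\<close> for every
  \<open>\<mu> : A \<rightarrow> B\<close>. It remains to see that each \<open>s\<^sub>A\<close> is a homomorphism.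

  For \<open>\<nu> : F(x\<^sub>0) \<rightarrow> F\<^sup>0\<close> the composite \<open>\<nu> \<nu>\<^sub>0\<close> is an endomorphism of \<open>F\<^sup>0\<close>, so
  \<open>\<nu> \<nu>\<^sub>0 = \<phi>(\<nu> \<nu>\<^sub>0) = \<phi>(\<nu>) \<nu>\<^sub>0\<close>; at any \<open>x \<in> X\<^sub>0\<close> this says \<open>\<nu>(x\<^sub>0) = \<phi>(\<nu>)(x\<^sub>0)\<close>. Hence
  \<open>s\<close> is the identity on \<open>F\<^sup>0\<close>, and \<open>\<phi>(\<mu>) s\<^sub>A = \<mu>\<close> for every \<open>\<mu> : A \<rightarrow> F\<^sup>0\<close>. Both \<open>\<mu>\<close> and \<open>\<phi>(\<mu>)\<close>
  being homomorphisms, \<open>\<phi>(\<mu>)\<close> takes the same value on \<open>s\<^sub>A(f(a\<^sub>1, \<dots>, a\<^sub>n))\<close> and on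
  \<open>f(s\<^sub>A(a\<^sub>1), \<dots>, s\<^sub>A(a\<^sub>n))\<close>. Every morphism \<open>A \<rightarrow> F\<^sup>0\<close> has the form \<open>\<phi>(\<mu>)\<close>, and since \<open>F\<^sup>0\<close>
  generates the variety these morphisms separate the points of \<open>A\<close>
  (\<open>homs_to_generating_algebra_separate\<close>), so the two elements are equal.

  What this needs of free algebras is that they lie in the variety and have the universal property
  (\<open>free_algebra_in_variety\<close>, \<open>free_algebra_extend\<close>).\<close>

section \<open>Evaluation of terms, homomorphisms and quotients\<close>

lemma eval_trm_closed:
  assumes A: "is_algebra \<Sigma> A" and t: "t \<in> terms \<Sigma> X" and \<rho>: "\<rho> \<in> X \<rightarrow> carrier A"
  shows "eval_trm A \<rho> t \<in> carrier A"
  using t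
proof induction
  case (1 x)
  then show ?case using \<rho> by auto
next
  case (2 f ts)
  then have "map (eval_trm A \<rho>) ts \<in> lists (carrier A)" by auto
  then show ?case using 2 A unfolding is_algebra_def by auto
qed

lemma eval_trm_cong:
  assumes "t \<in> terms \<Sigma> X" and "\<And>x. x \<in> X \<Longrightarrow> \<rho> x = \<sigma> x"
  shows "eval_trm A \<rho> t = eval_trm A \<sigma> t"
  using assms(1)
proof induction
  case (1 x)
  then show ?case using assms(2) by simp
next
  case (2 f ts)
  then have "map (eval_trm A \<rho>) ts = map (eval_trm A \<sigma>) ts" by simp
  then show ?case by (simp del: map_eq_conv)
qed

lemma terms_mono:
  assumes "t \<in> terms \<Sigma> X" and "X \<subseteq> Y"
  shows "t \<in> terms \<Sigma> Y"
  using assms(1) by induction (use assms(2) in \<open>auto intro: terms.intros\<close>)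

lemma homs_eval_trm:
  assumes A: "is_algebra \<Sigma> A" and h: "h \<in> homs \<Sigma> A B"
    and t: "t \<in> terms \<Sigma> X" and \<rho>: "\<rho> \<in> X \<rightarrow> carrier A"
  shows "h (eval_trm A \<rho> t) = eval_trm B (\<lambda>x. h (\<rho> x)) t"
  using t
proof induction
  case (1 x)
  then show ?case by simp
next
  case (2 f ts)
  have "map (eval_trm A \<rho>) ts \<in> lists (carrier A)"
    using 2 eval_trm_closed[OF A _ \<rho>] by auto
  then have "h (eval_trm A \<rho> (App f ts)) = op B f (map h (map (eval_trm A \<rho>) ts))"
    using h 2 unfolding homs_def by auto
  also have "map h (map (eval_trm A \<rho>) ts) = map (eval_trm B (\<lambda>x. h (\<rho> x))) ts"
    using 2 by simp
  finally show ?case by simp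
qed

lemma homs_compose:
  assumes "g \<in> homs \<Sigma> B D" and "h \<in> homs \<Sigma> A B" and A: "is_algebra \<Sigma> A"
  shows "compose (carrier A) g h \<in> homs \<Sigma> A D"
proof -
  have h: "h \<in> carrier A \<rightarrow> carrier B" using assms unfolding homs_def by auto
  have g: "g \<in> carrier B \<rightarrow> carrier D" using assms unfolding homs_def by auto
  have "compose (carrier A) g h (op A f as) = op D f (map (compose (carrier A) g h) as)"
    if f: "f \<in> symbols \<Sigma>" "as \<in> lists (carrier A)" "length as = arity \<Sigma> f" for f as
  proof -
    have "op A f as \<in> carrier A" using A f unfolding is_algebra_def by auto
    moreover have "map h as \<in> lists (carrier B)" using f funcset_mem[OF h] by (simp add: in_listsI in_lists_conv_set)
    moreover have "map (compose (carrier A) g h) as = map g (map h as)"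
      using f by (auto simp: compose_def)
    ultimately show ?thesis
      using assms f unfolding homs_def by (simp add: compose_def del: map_eq_conv map_map)
  qed
  moreover have "compose (carrier A) g h \<in> carrier A \<rightarrow>\<^sub>E carrier D"
    using g h by (auto simp: compose_def)
  ultimately show ?thesis unfolding homs_def by auto
qed

lemma homs_inverse:
  assumes A: "is_algebra \<Sigma> A" and h: "h \<in> homs \<Sigma> A B" and bij: "bij_betw h (carrier A) (carrier B)"
  shows "restrict (inv_into (carrier A) h) (carrier B) \<in> homs \<Sigma> B A"
proof -
  let ?k = "restrict (inv_into (carrier A) h) (carrier B)"
  have k: "?k b \<in> carrier A" "h (?k b) = b" if "b \<in> carrier B" for b
    using bij that by (auto simp: bij_betw_def inv_into_into f_inv_into_f)
  have hk: "?k (h a) = a" if "a \<in> carrier A" for a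
    using bij that by (auto simp: bij_betw_def)
  have "?k (op B f bs) = op A f (map ?k bs)"
    if f: "f \<in> symbols \<Sigma>" "bs \<in> lists (carrier B)" "length bs = arity \<Sigma> f" for f bs
  proof -
    have as: "map ?k bs \<in> lists (carrier A)" using f k by auto
    then have "h (op A f (map ?k bs)) = op B f (map h (map ?k bs))"
      using h f unfolding homs_def by simp
    also have "map h (map ?k bs) = bs"
      unfolding map_map by (rule map_idI) (use f k in auto)
    finally have "?k (op B f bs) = ?k (h (op A f (map ?k bs)))" by (rule arg_cong[OF sym])
    also have "\<dots> = op A f (map ?k bs)"
      by (rule hk) (use as A f in \<open>simp add: is_algebra_def\<close>)
    finally show ?thesis .
  qed
  moreover have "?k \<in> carrier B \<rightarrow>\<^sub>E carrier A" using k by auto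
  ultimately show ?thesis unfolding homs_def by auto
qed

lemma op_quotient_algebra:
  assumes \<theta>: "is_congruence \<Sigma> A \<theta>" and f: "f \<in> symbols \<Sigma>" "length as = arity \<Sigma> f"
    and as: "as \<in> lists (carrier A)"
  shows "op (quotient_algebra A \<theta>) f (map (\<lambda>a. \<theta> `` {a}) as) = \<theta> `` {op A f as}"
proof -
  have eq: "equiv (carrier A) \<theta>" using \<theta> unfolding is_congruence_def by auto
  have refl: "list_all2 (\<in>) as (map (\<lambda>a. \<theta> `` {a}) as)"
  proof -
    have "a \<in> \<theta> `` {a}" if "a \<in> set as" for a
      using as that by (intro equiv_class_self[OF eq]) auto
    then show ?thesis unfolding list.rel_map by (intro list.rel_refl_strong)
  qed
  have "\<theta> `` {op A f bs} = \<theta> `` {op A f as}"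
    if "list_all2 (\<in>) bs (map (\<lambda>a. \<theta> `` {a}) as)" for bs
  proof -
    have "list_all2 (\<lambda>a b. (a, b) \<in> \<theta>) as bs"
      using that by (auto simp: list_all2_conv_all_nth)
    then have "(op A f as, op A f bs) \<in> \<theta>"
      using \<theta> f unfolding is_congruence_def by auto
    then show ?thesis using equiv_class_eq[OF eq] by auto
  qed
  then have "\<theta> `` {op A f bs |bs. list_all2 (\<in>) bs (map (\<lambda>a. \<theta> `` {a}) as)} = \<theta> `` {op A f as}"
    using refl by blast
  then show ?thesis by (simp add: quotient_algebra_def)
qed

lemma carrier_quotient_algebra: "carrier (quotient_algebra A \<theta>) = carrier A // \<theta>"
  by (simp add: quotient_algebra_def)

lemma lift_to_representatives:
  assumes "Cs \<in> lists (A // \<theta>)"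
  obtains as where "as \<in> lists A" and "Cs = map (\<lambda>a. \<theta> `` {a}) as"
proof -
  have "\<exists>as\<in>lists A. Cs = map (\<lambda>a. \<theta> `` {a}) as"
    using assms
  proof induction
    case Nil
    then show ?case by auto
  next
    case (Cons C Cs)
    then obtain as where "as \<in> lists A" "Cs = map (\<lambda>a. \<theta> `` {a}) as" by blast
    moreover obtain a where "a \<in> A" "C = \<theta> `` {a}" using \<open>C \<in> A // \<theta>\<close> by (rule quotientE)
    ultimately show ?case by (intro bexI[of _ "a # as"]) simp_all
  qed
  then show ?thesis using that by auto
qed

lemma is_algebra_quotient:
  assumes A: "is_algebra \<Sigma> A" and \<theta>: "is_congruence \<Sigma> A \<theta>"
  shows "is_algebra \<Sigma> (quotient_algebra A \<theta>)"
  unfolding is_algebra_def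
proof (intro ballI impI)
  fix f Cs
  assume f: "f \<in> symbols \<Sigma>" "length Cs = arity \<Sigma> f"
    and Cs: "Cs \<in> lists (carrier (quotient_algebra A \<theta>))"
  obtain as where as: "as \<in> lists (carrier A)" "Cs = map (\<lambda>a. \<theta> `` {a}) as"
    using lift_to_representatives[OF Cs[unfolded carrier_quotient_algebra]] .
  then have "length as = arity \<Sigma> f" using f by simp
  then have "op (quotient_algebra A \<theta>) f Cs = \<theta> `` {op A f as}" and "op A f as \<in> carrier A"
    using A f op_quotient_algebra[OF \<theta> f(1) _ as(1)] as by (simp_all add: is_algebra_def)
  then show "op (quotient_algebra A \<theta>) f Cs \<in> carrier (quotient_algebra A \<theta>)"
    by (simp add: carrier_quotient_algebra quotientI)
qed

lemma projection_homs:
  assumes A: "is_algebra \<Sigma> A" and \<theta>: "is_congruence \<Sigma> A \<theta>"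
  shows "(\<lambda>a\<in>carrier A. \<theta> `` {a}) \<in> homs \<Sigma> A (quotient_algebra A \<theta>)"
proof -
  have "(\<lambda>a\<in>carrier A. \<theta> `` {a}) (op A f as) =
      op (quotient_algebra A \<theta>) f (map (\<lambda>a\<in>carrier A. \<theta> `` {a}) as)"
    if f: "f \<in> symbols \<Sigma>" "length as = arity \<Sigma> f" "as \<in> lists (carrier A)" for f as
  proof -
    have "map (\<lambda>a\<in>carrier A. \<theta> `` {a}) as = map (\<lambda>a. \<theta> `` {a}) as" using f by auto
    moreover have "op A f as \<in> carrier A" using A f by (simp add: is_algebra_def)
    ultimately show ?thesis
      using f op_quotient_algebra[OF \<theta>, of f as] by (simp del: map_eq_conv)
  qed
  moreover have "(\<lambda>a\<in>carrier A. \<theta> `` {a}) \<in> carrier A \<rightarrow>\<^sub>E carrier (quotient_algebra A \<theta>)"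
    by (simp add: carrier_quotient_algebra quotientI)
  ultimately show ?thesis unfolding homs_def by blast
qed

lemma eval_trm_quotient:
  assumes A: "is_algebra \<Sigma> A" and \<theta>: "is_congruence \<Sigma> A \<theta>"
    and t: "t \<in> terms \<Sigma> X" and \<sigma>: "\<sigma> \<in> X \<rightarrow> carrier A"
  shows "eval_trm (quotient_algebra A \<theta>) (\<lambda>x. \<theta> `` {\<sigma> x}) t = \<theta> `` {eval_trm A \<sigma> t}"
proof -
  have "\<theta> `` {eval_trm A \<sigma> t} = (\<lambda>a\<in>carrier A. \<theta> `` {a}) (eval_trm A \<sigma> t)"
    using eval_trm_closed[OF A t \<sigma>] by simp
  also have "\<dots> = eval_trm (quotient_algebra A \<theta>) (\<lambda>x. (\<lambda>a\<in>carrier A. \<theta> `` {a}) (\<sigma> x)) t"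
    by (rule homs_eval_trm[OF A projection_homs[OF A \<theta>] t \<sigma>])
  also have "\<dots> = eval_trm (quotient_algebra A \<theta>) (\<lambda>x. \<theta> `` {\<sigma> x}) t"
    by (rule eval_trm_cong[OF t]) (use \<sigma> in auto)
  finally show ?thesis ..
qed

lemma satisfies_quotient_iff:
  fixes s t :: "('f, 'v) trm"
  assumes A: "is_algebra \<Sigma> (A :: ('f, 'a) algebra)" and \<theta>: "is_congruence \<Sigma> A \<theta>"
    and s: "s \<in> terms \<Sigma> UNIV" and t: "t \<in> terms \<Sigma> UNIV"
  shows "satisfies (quotient_algebra A \<theta>) s t \<longleftrightarrow>
    (\<forall>\<sigma>\<in>UNIV \<rightarrow> carrier A. (eval_trm A \<sigma> s, eval_trm A \<sigma> t) \<in> \<theta>)" (is "?L \<longleftrightarrow> ?R")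
proof -
  have eq: "equiv (carrier A) \<theta>" using \<theta> unfolding is_congruence_def by auto
  have ev: "eval_trm (quotient_algebra A \<theta>) (\<lambda>x. \<theta> `` {\<sigma> x}) s =
        eval_trm (quotient_algebra A \<theta>) (\<lambda>x. \<theta> `` {\<sigma> x}) t \<longleftrightarrow>
      (eval_trm A \<sigma> s, eval_trm A \<sigma> t) \<in> \<theta>"
    if "\<sigma> \<in> UNIV \<rightarrow> carrier A" for \<sigma> :: "'v \<Rightarrow> 'a"
    using eval_trm_quotient[OF A \<theta> s that] eval_trm_quotient[OF A \<theta> t that]
      eq_equiv_class_iff[OF eq eval_trm_closed[OF A s that] eval_trm_closed[OF A t that]]
    by simp
  show ?thesis
  proof
    assume ?L
    show ?R
    proof
      fix \<sigma> :: "'v \<Rightarrow> 'a" assume \<sigma>: "\<sigma> \<in> UNIV \<rightarrow> carrier A"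
      then have "(\<lambda>x. \<theta> `` {\<sigma> x}) \<in> UNIV \<rightarrow> carrier (quotient_algebra A \<theta>)"
        by (auto simp: carrier_quotient_algebra intro: quotientI)
      then show "(eval_trm A \<sigma> s, eval_trm A \<sigma> t) \<in> \<theta>"
        using \<open>?L\<close> ev[OF \<sigma>] unfolding satisfies_def by blast
    qed
  next
    assume R: ?R
    show ?L
      unfolding satisfies_def
    proof
      fix \<rho> :: "'v \<Rightarrow> 'a set" assume "\<rho> \<in> UNIV \<rightarrow> carrier (quotient_algebra A \<theta>)"
      then have "\<rho> x \<in> carrier A // \<theta>" for x
        by (auto simp: carrier_quotient_algebra)
      then have "\<exists>a. a \<in> carrier A \<and> \<rho> x = \<theta> `` {a}" for x
        by (meson quotientE)
      then obtain \<sigma> where "\<And>x. \<sigma> x \<in> carrier A" "\<And>x. \<rho> x = \<theta> `` {\<sigma> x}" by metis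
      then have "\<sigma> \<in> UNIV \<rightarrow> carrier A" and "\<rho> = (\<lambda>x. \<theta> `` {\<sigma> x})" by auto
      then show "eval_trm (quotient_algebra A \<theta>) \<rho> s = eval_trm (quotient_algebra A \<theta>) \<rho> t"
        using ev R by blast
    qed
  qed
qed

lemma is_congruence_Inter:
  assumes "S \<noteq> {}" and "\<And>\<theta>. \<theta> \<in> S \<Longrightarrow> is_congruence \<Sigma> A \<theta>"
  shows "is_congruence \<Sigma> A (\<Inter>S)"
proof -
  have eq: "equiv (carrier A) \<theta>" if "\<theta> \<in> S" for \<theta>
    using assms(2)[OF that] by (simp add: is_congruence_def)
  obtain \<theta>\<^sub>1 where "\<theta>\<^sub>1 \<in> S" using assms(1) by auto
  then have "\<Inter>S \<subseteq> carrier A \<times> carrier A" using equiv_type[OF eq] by blast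
  moreover have "refl_on (carrier A) (\<Inter>S)"
    using eq by (auto simp: refl_on_def equiv_def)
  moreover have "sym (\<Inter>S)"
    using eq by (intro symI) (simp add: equiv_def sym_def)
  moreover have "trans (\<Inter>S)"
  proof (intro transI InterI)
    fix a b c \<theta> assume "(a, b) \<in> \<Inter>S" "(b, c) \<in> \<Inter>S" "\<theta> \<in> S"
    then have "(a, b) \<in> \<theta>" "(b, c) \<in> \<theta>" "trans \<theta>"
      using eq by (auto simp: equiv_def)
    then show "(a, c) \<in> \<theta>" by (blast dest: transD)
  qed
  ultimately have "equiv (carrier A) (\<Inter>S)" by (simp add: equiv_def)
  moreover have "(op A f as, op A f bs) \<in> \<Inter>S"
    if "f \<in> symbols \<Sigma>" "length as = arity \<Sigma> f" "list_all2 (\<lambda>a b. (a, b) \<in> \<Inter>S) as bs" for f as bs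
  proof
    fix \<theta> assume "\<theta> \<in> S"
    moreover have "list_all2 (\<lambda>a b. (a, b) \<in> \<theta>) as bs"
      by (rule list_all2_mono[OF that(3)]) (use \<open>\<theta> \<in> S\<close> in blast)
    ultimately show "(op A f as, op A f bs) \<in> \<theta>"
      using assms(2)[of \<theta>] that(1,2) unfolding is_congruence_def by blast
  qed
  ultimately show ?thesis unfolding is_congruence_def by blast
qed


section \<open>Free algebras of a variety\<close>

lemma is_algebra_term_algebra: "is_algebra \<Sigma> (term_algebra \<Sigma> X)"
  by (auto simp: is_algebra_def term_algebra_def intro!: terms.intros)

lemma carrier_term_algebra [simp]: "carrier (term_algebra \<Sigma> X) = terms \<Sigma> X"
  by (simp add: term_algebra_def)

lemma op_term_algebra [simp]: "op (term_algebra \<Sigma> X) = App"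
  by (simp add: term_algebra_def)

lemma eval_trm_Var: "eval_trm (term_algebra \<Sigma> X) Var t = t"
  by (induction t) (simp_all add: map_idI)

lemma kernel_congruence:
  assumes B: "is_algebra \<Sigma> B" and \<rho>: "\<rho> \<in> X \<rightarrow> carrier B"
  shows "is_congruence \<Sigma> (term_algebra \<Sigma> X)
    {(s, t). s \<in> terms \<Sigma> X \<and> t \<in> terms \<Sigma> X \<and> eval_trm B \<rho> s = eval_trm B \<rho> t}" (is "is_congruence _ _ ?K")
proof -
  have "equiv (terms \<Sigma> X) ?K"
    by (rule equivI) (auto intro!: refl_onI symI transI)
  moreover have "(App f as, App f bs) \<in> ?K"
    if f: "f \<in> symbols \<Sigma>" "length as = arity \<Sigma> f" and l: "list_all2 (\<lambda>a b. (a, b) \<in> ?K) as bs"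
    for f as bs
  proof -
    have "length bs = length as" using l by (simp add: list_all2_lengthD)
    moreover have "\<forall>t\<in>set as. t \<in> terms \<Sigma> X" "\<forall>t\<in>set bs. t \<in> terms \<Sigma> X"
      using l by (auto simp: list_all2_conv_all_nth in_set_conv_nth)
    moreover have "map (eval_trm B \<rho>) as = map (eval_trm B \<rho>) bs"
      using l by (auto simp: list_all2_conv_all_nth intro!: nth_equalityI)
    ultimately show ?thesis
      using f by (auto simp del: map_eq_conv intro!: terms.intros)
  qed
  ultimately show ?thesis unfolding is_congruence_def by simp
qed

lemma is_varietyE:
  fixes \<Theta> :: "('f, 'v) alg set"
  assumes "is_variety \<Sigma> \<Theta>"
  obtains E where "E \<subseteq> terms \<Sigma> (UNIV :: 'v set) \<times> terms \<Sigma> UNIV"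
    and "\<Theta> = {A. is_algebra \<Sigma> A \<and> (\<forall>(s, t)\<in>E. satisfies A s t)}"
  using assms unfolding is_variety_def by blast

lemma is_variety_is_algebra: "is_variety \<Sigma> \<Theta> \<Longrightarrow> A \<in> \<Theta> \<Longrightarrow> is_algebra \<Sigma> A"
  unfolding is_variety_def by auto

text \<open>The least congruence with quotient in \<open>\<Theta>\<close> exists: the total relation is a congruence with
  quotient in \<open>\<Theta>\<close>, and satisfaction of an identity by a quotient is preserved under intersection of
  congruences.\<close>

lemma
  fixes \<Theta> :: "('f, 'v) alg set"
  assumes \<Theta>: "is_variety \<Sigma> \<Theta>"
  shows is_congruence_free_congruence: "is_congruence \<Sigma> (term_algebra \<Sigma> X) (free_congruence \<Sigma> \<Theta> X)"
    and free_algebra_in_variety: "free_algebra \<Sigma> \<Theta> X \<in> \<Theta>"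
proof -
  let ?T = "term_algebra \<Sigma> X"
  obtain E where E: "E \<subseteq> terms \<Sigma> (UNIV :: 'v set) \<times> terms \<Sigma> UNIV"
    and \<Theta>_def: "\<Theta> = {A. is_algebra \<Sigma> A \<and> (\<forall>(s, t)\<in>E. satisfies A s t)}"
    using is_varietyE[OF \<Theta>] .
  note T = is_algebra_term_algebra[of \<Sigma> X]
  have iff: "quotient_algebra ?T \<theta> \<in> \<Theta> \<longleftrightarrow>
      (\<forall>(s, t)\<in>E. \<forall>\<sigma>\<in>UNIV \<rightarrow> terms \<Sigma> X. (eval_trm ?T \<sigma> s, eval_trm ?T \<sigma> t) \<in> \<theta>)"
    if cong: "is_congruence \<Sigma> ?T \<theta>" for \<theta>
  proof -
    have "(\<forall>(s, t)\<in>E. satisfies (quotient_algebra ?T \<theta>) s t) \<longleftrightarrow>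
        (\<forall>(s, t)\<in>E. \<forall>\<sigma>\<in>UNIV \<rightarrow> terms \<Sigma> X. (eval_trm ?T \<sigma> s, eval_trm ?T \<sigma> t) \<in> \<theta>)"
    proof (rule ball_cong[OF refl], unfold split_paired_all prod.case)
      fix s t assume "(s, t) \<in> E"
      then have "s \<in> terms \<Sigma> UNIV" "t \<in> terms \<Sigma> UNIV" using E by auto
      from satisfies_quotient_iff[OF T cong this]
      show "satisfies (quotient_algebra ?T \<theta>) s t \<longleftrightarrow>
          (\<forall>\<sigma>\<in>UNIV \<rightarrow> terms \<Sigma> X. (eval_trm ?T \<sigma> s, eval_trm ?T \<sigma> t) \<in> \<theta>)"
        unfolding carrier_term_algebra .
    qed
    then show ?thesis using is_algebra_quotient[OF T cong] unfolding \<Theta>_def by blast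
  qed
  define S where "S = {\<theta>. is_congruence \<Sigma> ?T \<theta> \<and> quotient_algebra ?T \<theta> \<in> \<Theta>}"
  have "is_congruence \<Sigma> ?T (terms \<Sigma> X \<times> terms \<Sigma> X)" (is "is_congruence _ _ ?all")
  proof -
    have "equiv (terms \<Sigma> X) ?all"
      by (rule equivI) (auto intro!: refl_onI symI transI)
    then show ?thesis
      unfolding is_congruence_def
      by (auto simp: list_all2_conv_all_nth in_set_conv_nth intro!: terms.intros)
  qed
  moreover have "quotient_algebra ?T ?all \<in> \<Theta>"
    unfolding iff[OF calculation]
  proof clarify
    fix s t and \<sigma> :: "'v \<Rightarrow> ('f, 'v) trm"
    assume "(s, t) \<in> E" and \<sigma>: "\<sigma> \<in> UNIV \<rightarrow> terms \<Sigma> X"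
    then have "s \<in> terms \<Sigma> UNIV" "t \<in> terms \<Sigma> UNIV" using E by auto
    then show "eval_trm ?T \<sigma> s \<in> terms \<Sigma> X \<and> eval_trm ?T \<sigma> t \<in> terms \<Sigma> X"
      using eval_trm_closed[OF T, of _ UNIV \<sigma>] \<sigma> by simp
  qed
  ultimately have "S \<noteq> {}" unfolding S_def by blast
  have free: "free_congruence \<Sigma> \<Theta> X = \<Inter>S"
    by (simp add: free_congruence_def S_def)
  show cong: "is_congruence \<Sigma> ?T (free_congruence \<Sigma> \<Theta> X)"
    unfolding free by (rule is_congruence_Inter[OF \<open>S \<noteq> {}\<close>]) (simp add: S_def)
  have "\<forall>\<theta>\<in>S. \<forall>(s, t)\<in>E. \<forall>\<sigma>\<in>UNIV \<rightarrow> terms \<Sigma> X. (eval_trm ?T \<sigma> s, eval_trm ?T \<sigma> t) \<in> \<theta>"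
    using iff unfolding S_def by blast
  then have "\<forall>(s, t)\<in>E. \<forall>\<sigma>\<in>UNIV \<rightarrow> terms \<Sigma> X.
      (eval_trm ?T \<sigma> s, eval_trm ?T \<sigma> t) \<in> free_congruence \<Sigma> \<Theta> X"
    unfolding free by blast
  then show "free_algebra \<Sigma> \<Theta> X \<in> \<Theta>"
    unfolding free_algebra_def iff[OF cong] .
qed

lemma is_algebra_free_algebra: "is_variety \<Sigma> \<Theta> \<Longrightarrow> is_algebra \<Sigma> (free_algebra \<Sigma> \<Theta> X)"
  using is_variety_is_algebra free_algebra_in_variety by blast

lemma carrier_free_algebra: "carrier (free_algebra \<Sigma> \<Theta> X) = terms \<Sigma> X // free_congruence \<Sigma> \<Theta> X"
  by (simp add: free_algebra_def carrier_quotient_algebra)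

lemma generator_in_carrier: "x \<in> X \<Longrightarrow> generator \<Sigma> \<Theta> X x \<in> carrier (free_algebra \<Sigma> \<Theta> X)"
  by (auto simp: carrier_free_algebra generator_def intro!: quotientI terms.intros)

lemma eval_trm_generator:
  assumes "is_variety \<Sigma> \<Theta>" and "t \<in> terms \<Sigma> X"
  shows "eval_trm (free_algebra \<Sigma> \<Theta> X) (generator \<Sigma> \<Theta> X) t = free_congruence \<Sigma> \<Theta> X `` {t}"
proof -
  have "Var \<in> X \<rightarrow> carrier (term_algebra \<Sigma> X)" by (auto intro: terms.intros)
  from eval_trm_quotient[OF is_algebra_term_algebra is_congruence_free_congruence[OF assms(1)]
      assms(2) this]
  show ?thesis
    by (simp add: free_algebra_def generator_def[abs_def] eval_trm_Var)
qed

text \<open>The free algebra is generated by its generators.\<close>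

lemma free_algebra_elem:
  assumes "is_variety \<Sigma> \<Theta>" and "c \<in> carrier (free_algebra \<Sigma> \<Theta> X)"
  obtains t where "t \<in> terms \<Sigma> X"
    and "c = eval_trm (free_algebra \<Sigma> \<Theta> X) (generator \<Sigma> \<Theta> X) t"
proof -
  from assms(2) obtain u where u: "u \<in> terms \<Sigma> X" "c = free_congruence \<Sigma> \<Theta> X `` {u}"
    unfolding carrier_free_algebra by (rule quotientE)
  show ?thesis
    by (rule that[OF u(1)]) (simp only: u(2) eval_trm_generator[OF assms(1) u(1)])
qed

lemma homs_free_algebra_eval:
  assumes "is_variety \<Sigma> \<Theta>" and "h \<in> homs \<Sigma> (free_algebra \<Sigma> \<Theta> X) B" and "t \<in> terms \<Sigma> X"
  shows "h (eval_trm (free_algebra \<Sigma> \<Theta> X) (generator \<Sigma> \<Theta> X) t) =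
    eval_trm B (\<lambda>x. h (generator \<Sigma> \<Theta> X x)) t"
  by (rule homs_eval_trm[OF is_algebra_free_algebra[OF assms(1)] assms(2,3)])
    (simp add: generator_in_carrier)

lemma free_algebra_homs_eqI:
  assumes \<Theta>: "is_variety \<Sigma> \<Theta>"
    and g: "g \<in> homs \<Sigma> (free_algebra \<Sigma> \<Theta> X) B" and h: "h \<in> homs \<Sigma> (free_algebra \<Sigma> \<Theta> X) B"
    and gen: "\<And>x. x \<in> X \<Longrightarrow> g (generator \<Sigma> \<Theta> X x) = h (generator \<Sigma> \<Theta> X x)"
  shows "g = h"
proof (rule extensionalityI)
  show "g \<in> extensional (carrier (free_algebra \<Sigma> \<Theta> X))"
    and "h \<in> extensional (carrier (free_algebra \<Sigma> \<Theta> X))"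
    using g h by (auto simp: homs_def PiE_iff)
next
  fix c assume "c \<in> carrier (free_algebra \<Sigma> \<Theta> X)"
  then obtain t where t: "t \<in> terms \<Sigma> X"
    and c: "c = eval_trm (free_algebra \<Sigma> \<Theta> X) (generator \<Sigma> \<Theta> X) t"
    using free_algebra_elem[OF \<Theta>] by blast
  show "g c = h c"
    unfolding c homs_free_algebra_eval[OF \<Theta> g t] homs_free_algebra_eval[OF \<Theta> h t]
    by (rule eval_trm_cong[OF t]) (simp add: gen)
qed

text \<open>The universal property. The kernel of evaluation in \<open>B\<close> is one of the congruences whose
  intersection is the free congruence, so evaluation factors through the free algebra.\<close>

lemma free_algebra_extend:
  fixes \<Theta> :: "('f, 'v) alg set"
  assumes \<Theta>: "is_variety \<Sigma> \<Theta>" and B: "B \<in> \<Theta>" and \<rho>: "\<rho> \<in> X \<rightarrow> carrier B"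
  obtains h where "h \<in> homs \<Sigma> (free_algebra \<Sigma> \<Theta> X) B"
    and "\<And>x. x \<in> X \<Longrightarrow> h (generator \<Sigma> \<Theta> X x) = \<rho> x"
proof -
  let ?T = "term_algebra \<Sigma> X" and ?\<theta> = "free_congruence \<Sigma> \<Theta> X" and ?F = "free_algebra \<Sigma> \<Theta> X"
  define K where
    "K = {(s, t). s \<in> terms \<Sigma> X \<and> t \<in> terms \<Sigma> X \<and> eval_trm B \<rho> s = eval_trm B \<rho> t}"
  note T = is_algebra_term_algebra[of \<Sigma> X]
  have algB: "is_algebra \<Sigma> B" using is_variety_is_algebra[OF \<Theta> B] .
  have cong: "is_congruence \<Sigma> ?T K"
    unfolding K_def by (rule kernel_congruence[OF algB \<rho>])
  obtain E where E: "E \<subseteq> terms \<Sigma> (UNIV :: 'v set) \<times> terms \<Sigma> UNIV"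
    and \<Theta>_def: "\<Theta> = {A. is_algebra \<Sigma> A \<and> (\<forall>(s, t)\<in>E. satisfies A s t)}"
    using is_varietyE[OF \<Theta>] .
  have subst: "eval_trm B \<rho> (eval_trm ?T \<sigma> t) = eval_trm B (\<lambda>x. eval_trm B \<rho> (\<sigma> x)) t" for \<sigma> :: "'v \<Rightarrow> _" and t
    by (induction t) (auto intro!: arg_cong[of _ _ "op B _"])
  have "satisfies (quotient_algebra ?T K) s t" if st: "(s, t) \<in> E" for s t
  proof -
    have s: "s \<in> terms \<Sigma> UNIV" and t: "t \<in> terms \<Sigma> UNIV" using st E by auto
    show ?thesis
      unfolding satisfies_quotient_iff[OF T cong s t]
    proof
      fix \<sigma> :: "'v \<Rightarrow> _" assume \<sigma>: "\<sigma> \<in> UNIV \<rightarrow> carrier ?T"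
      have "(\<lambda>x. eval_trm B \<rho> (\<sigma> x)) \<in> UNIV \<rightarrow> carrier B"
        using \<sigma> eval_trm_closed[OF algB _ \<rho>] by auto
      then have "eval_trm B \<rho> (eval_trm ?T \<sigma> s) = eval_trm B \<rho> (eval_trm ?T \<sigma> t)"
        using B st unfolding subst \<Theta>_def satisfies_def by blast
      then show "(eval_trm ?T \<sigma> s, eval_trm ?T \<sigma> t) \<in> K"
        using eval_trm_closed[OF T s \<sigma>] eval_trm_closed[OF T t \<sigma>] by (simp add: K_def)
    qed
  qed
  then have "quotient_algebra ?T K \<in> \<Theta>"
    unfolding \<Theta>_def using is_algebra_quotient[OF T cong] by auto
  with cong have sub: "?\<theta> \<subseteq> K" unfolding free_congruence_def by auto
  have cong\<theta>: "is_congruence \<Sigma> ?T ?\<theta>" by (rule is_congruence_free_congruence[OF \<Theta>])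
  then have eq: "equiv (terms \<Sigma> X) ?\<theta>" by (simp add: is_congruence_def)
  define h where "h = (\<lambda>c\<in>carrier ?F. eval_trm B \<rho> (SOME t. t \<in> c))"
  have h: "h (?\<theta> `` {t}) = eval_trm B \<rho> t" if t: "t \<in> terms \<Sigma> X" for t
  proof -
    have "t \<in> ?\<theta> `` {t}" by (rule equiv_class_self[OF eq t])
    then have "(SOME u. u \<in> ?\<theta> `` {t}) \<in> ?\<theta> `` {t}" by (rule someI)
    then have "(t, SOME u. u \<in> ?\<theta> `` {t}) \<in> K" using sub by auto
    moreover have "?\<theta> `` {t} \<in> carrier ?F" unfolding carrier_free_algebra by (rule quotientI[OF t])
    ultimately show ?thesis by (simp add: h_def K_def)
  qed
  have "h (op ?F f Cs) = op B f (map h Cs)"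
    if f: "f \<in> symbols \<Sigma>" "length Cs = arity \<Sigma> f" and Cs: "Cs \<in> lists (carrier ?F)" for f Cs
  proof -
    obtain ts where ts: "ts \<in> lists (terms \<Sigma> X)" "Cs = map (\<lambda>a. ?\<theta> `` {a}) ts"
      using lift_to_representatives[OF Cs[unfolded carrier_free_algebra]] .
    have "op ?F f Cs = ?\<theta> `` {App f ts}"
      using op_quotient_algebra[OF cong\<theta> f(1), of ts] f ts by (simp add: free_algebra_def)
    moreover have "App f ts \<in> terms \<Sigma> X" using f ts by (auto intro!: terms.intros)
    moreover have "map h Cs = map (eval_trm B \<rho>) ts" using ts h by auto
    ultimately show ?thesis using h by simp
  qed
  moreover have "h \<in> carrier ?F \<rightarrow>\<^sub>E carrier B"
  proof (rule PiE_I)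
    fix c assume "c \<in> carrier ?F"
    then obtain t where "t \<in> terms \<Sigma> X" "c = ?\<theta> `` {t}"
      unfolding carrier_free_algebra by (rule quotientE)
    then show "h c \<in> carrier B" using h eval_trm_closed[OF algB _ \<rho>] by simp
  qed (simp add: h_def)
  ultimately have "h \<in> homs \<Sigma> ?F B" unfolding homs_def by auto
  moreover have "h (generator \<Sigma> \<Theta> X x) = \<rho> x" if "x \<in> X" for x
    using h[of "Var x"] that by (simp add: generator_def terms.intros)
  ultimately show ?thesis using that by blast
qed

text \<open>If \<open>H\<close> generates \<open>\<Theta>\<close>, the homomorphisms to \<open>H\<close> separate the points of every free algebra:
  terms over \<open>X\<close> that are not separated form an identity of \<open>H\<close>, hence of all of \<open>\<Theta>\<close>.\<close>

lemma homs_to_generating_algebra_separate: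
  fixes \<Theta> :: "('f, 'v) alg set"
  assumes \<Theta>: "is_variety \<Sigma> \<Theta>" and gen: "\<Theta> = generated_variety \<Sigma> H" and H: "H \<in> \<Theta>"
    and c: "c \<in> carrier (free_algebra \<Sigma> \<Theta> X)" and d: "d \<in> carrier (free_algebra \<Sigma> \<Theta> X)"
    and sep: "\<And>\<mu>. \<mu> \<in> homs \<Sigma> (free_algebra \<Sigma> \<Theta> X) H \<Longrightarrow> \<mu> c = \<mu> d"
  shows "c = d"
proof -
  let ?F = "free_algebra \<Sigma> \<Theta> X" and ?g = "generator \<Sigma> \<Theta> X"
  obtain s where s: "s \<in> terms \<Sigma> X" "c = eval_trm ?F ?g s" using free_algebra_elem[OF \<Theta> c] .
  obtain t where t: "t \<in> terms \<Sigma> X" "d = eval_trm ?F ?g t" using free_algebra_elem[OF \<Theta> d] .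
  have "satisfies H s t"
    unfolding satisfies_def
  proof
    fix \<rho> :: "'v \<Rightarrow> ('f, 'v) trm set" assume "\<rho> \<in> UNIV \<rightarrow> carrier H"
    then have "\<rho> \<in> X \<rightarrow> carrier H" by auto
    then obtain h where h: "h \<in> homs \<Sigma> ?F H" "\<And>x. x \<in> X \<Longrightarrow> h (?g x) = \<rho> x"
      using free_algebra_extend[OF \<Theta> H] by blast
    have "eval_trm H \<rho> u = h (eval_trm ?F ?g u)" if u: "u \<in> terms \<Sigma> X" for u
      unfolding homs_free_algebra_eval[OF \<Theta> h(1) u] by (rule eval_trm_cong[OF u]) (simp add: h)
    then show "eval_trm H \<rho> s = eval_trm H \<rho> t" using sep[OF h(1)] s t by simp
  qed
  moreover have "is_variety \<Sigma> {A :: ('f, 'v) alg. is_algebra \<Sigma> A \<and> satisfies A s t}"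
    unfolding is_variety_def
    by (rule exI[of _ "{(s, t)}"]) (use s t terms_mono[of _ \<Sigma> X UNIV] in auto)
  ultimately have "\<Theta> \<subseteq> {A. is_algebra \<Sigma> A \<and> satisfies A s t}"
    using is_variety_is_algebra[OF \<Theta> H] unfolding gen generated_variety_def by blast
  then have "satisfies ?F s t" using free_algebra_in_variety[OF \<Theta>] by blast
  \<comment> \<open>An identity is tested on assignments of all variables; those outside \<open>X\<close> are sent to \<open>c\<close>.\<close>
  moreover have "(\<lambda>x. if x \<in> X then ?g x else c) \<in> UNIV \<rightarrow> carrier ?F"
    using c generator_in_carrier[of _ X \<Sigma> \<Theta>] by auto
  ultimately have "eval_trm ?F (\<lambda>x. if x \<in> X then ?g x else c) s =
      eval_trm ?F (\<lambda>x. if x \<in> X then ?g x else c) t"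
    unfolding satisfies_def by blast
  moreover have "eval_trm ?F (\<lambda>x. if x \<in> X then ?g x else c) u = eval_trm ?F ?g u"
    if "u \<in> terms \<Sigma> X" for u by (rule eval_trm_cong[OF that]) simp
  ultimately show ?thesis using s t by simp
qed

text \<open>The cyclic free algebra represents the underlying set functor.\<close>

lemma bij_betw_homs_cyclic:
  assumes \<Theta>: "is_variety \<Sigma> \<Theta>" and B: "B \<in> \<Theta>"
  shows "bij_betw (\<lambda>h. h (generator \<Sigma> \<Theta> {x} x)) (homs \<Sigma> (free_algebra \<Sigma> \<Theta> {x}) B) (carrier B)"
  unfolding bij_betw_def
proof
  show "inj_on (\<lambda>h. h (generator \<Sigma> \<Theta> {x} x)) (homs \<Sigma> (free_algebra \<Sigma> \<Theta> {x}) B)"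
  proof (rule inj_onI)
    fix g h assume g: "g \<in> homs \<Sigma> (free_algebra \<Sigma> \<Theta> {x}) B"
      and h: "h \<in> homs \<Sigma> (free_algebra \<Sigma> \<Theta> {x}) B"
      and eq: "g (generator \<Sigma> \<Theta> {x} x) = h (generator \<Sigma> \<Theta> {x} x)"
    show "g = h"
    proof (rule free_algebra_homs_eqI[OF \<Theta> g h])
      fix z assume "z \<in> {x}"
      then have "z = x" by simp
      then show "g (generator \<Sigma> \<Theta> {x} z) = h (generator \<Sigma> \<Theta> {x} z)" using eq by (simp only:)
    qed
  qed
  show "(\<lambda>h. h (generator \<Sigma> \<Theta> {x} x)) ` homs \<Sigma> (free_algebra \<Sigma> \<Theta> {x}) B = carrier B"
  proof (intro equalityI subsetI)
    fix b assume "b \<in> (\<lambda>h. h (generator \<Sigma> \<Theta> {x} x)) ` homs \<Sigma> (free_algebra \<Sigma> \<Theta> {x}) B"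
    then obtain h where h: "h \<in> homs \<Sigma> (free_algebra \<Sigma> \<Theta> {x}) B"
      and b: "b = h (generator \<Sigma> \<Theta> {x} x)" by (rule imageE)
    have "h \<in> carrier (free_algebra \<Sigma> \<Theta> {x}) \<rightarrow>\<^sub>E carrier B" using h by (simp add: homs_def)
    moreover have "generator \<Sigma> \<Theta> {x} x \<in> carrier (free_algebra \<Sigma> \<Theta> {x})"
      by (rule generator_in_carrier) simp
    ultimately show "b \<in> carrier B" unfolding b by (rule PiE_mem)
  next
    fix b assume "b \<in> carrier B"
    then have "(\<lambda>_. b) \<in> {x} \<rightarrow> carrier B" by simp
    then obtain h where h: "h \<in> homs \<Sigma> (free_algebra \<Sigma> \<Theta> {x}) B"
      and "\<And>z. z \<in> {x} \<Longrightarrow> h (generator \<Sigma> \<Theta> {x} z) = b"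
      using free_algebra_extend[OF \<Theta> B] by blast
    then have "b = h (generator \<Sigma> \<Theta> {x} x)" by simp
    then show "b \<in> (\<lambda>h. h (generator \<Sigma> \<Theta> {x} x)) ` homs \<Sigma> (free_algebra \<Sigma> \<Theta> {x}) B"
      using h by (rule image_eqI)
  qed
qed


section \<open>Automorphisms of the category of free algebras\<close>

lemma automorphism_bij_betw_Hom:
  assumes "is_automorphism C \<phi>" and fix_obj: "\<forall>A\<in>Obj C. obj_map \<phi> A = A"
    and A: "A \<in> Obj C" and B: "B \<in> Obj C"
  shows "bij_betw (arr_map \<phi> A B) (Hom C A B) (Hom C A B)"
proof -
  obtain \<psi> where \<psi>: "is_endofunctor C \<psi>" "left_inverse_functor C \<psi> \<phi>" "left_inverse_functor C \<phi> \<psi>"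
    and \<phi>: "is_endofunctor C \<phi>"
    using assms(1) unfolding is_automorphism_def by blast
  have "obj_map \<psi> D = D" if "D \<in> Obj C" for D
    using \<psi>(2) fix_obj that by (simp add: left_inverse_functor_def)
  then have eqs: "obj_map \<psi> A = A" "obj_map \<psi> B = B" "obj_map \<phi> A = A" "obj_map \<phi> B = B"
    using A B fix_obj by auto
  show ?thesis
  proof (rule bij_betw_byWitness[where f' = "arr_map \<psi> A B"])
    show "\<forall>f\<in>Hom C A B. arr_map \<psi> A B (arr_map \<phi> A B f) = f"
    proof
      fix f assume "f \<in> Hom C A B"
      then have "arr_map \<psi> (obj_map \<phi> A) (obj_map \<phi> B) (arr_map \<phi> A B f) = f"
        using \<psi>(2) A B unfolding left_inverse_functor_def by blast
      then show "arr_map \<psi> A B (arr_map \<phi> A B f) = f" by (simp only: eqs)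
    qed
    show "\<forall>f\<in>Hom C A B. arr_map \<phi> A B (arr_map \<psi> A B f) = f"
    proof
      fix f assume "f \<in> Hom C A B"
      then have "arr_map \<phi> (obj_map \<psi> A) (obj_map \<psi> B) (arr_map \<psi> A B f) = f"
        using \<psi>(3) A B unfolding left_inverse_functor_def by blast
      then show "arr_map \<phi> A B (arr_map \<psi> A B f) = f" by (simp only: eqs)
    qed
    show "arr_map \<phi> A B ` Hom C A B \<subseteq> Hom C A B"
      using \<phi>[unfolded is_endofunctor_def, THEN conjunct2, THEN conjunct1, rule_format, OF A B]
      unfolding eqs by blast
    show "arr_map \<psi> A B ` Hom C A B \<subseteq> Hom C A B"
      using \<psi>(1)[unfolded is_endofunctor_def, THEN conjunct2, THEN conjunct1, rule_format, OF A B]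
      unfolding eqs by blast
  qed
qed

theorem theorem3:
  fixes \<Sigma> :: "'f signature"
    and \<Theta> :: "('f, 'v) alg set"
    and X\<^sub>0 :: "'v set"
    and x\<^sub>0 :: 'v
    and \<nu>\<^sub>0 :: "('f, 'v) trm set \<Rightarrow> ('f, 'v) trm set"
    and \<phi> :: "(('f, 'v) alg, ('f, 'v) trm set \<Rightarrow> ('f, 'v) trm set) endofunctor"
  defines "F \<equiv> free_algebra \<Sigma> \<Theta>"
  assumes "infinite (UNIV :: 'v set)"
    and "is_hereditary \<Sigma> \<Theta> x\<^sub>0"
    and "finite X\<^sub>0" and "X\<^sub>0 \<noteq> {}"
    and "\<Theta> = generated_variety \<Sigma> (F X\<^sub>0)"
    and "\<nu>\<^sub>0 \<in> homs \<Sigma> (F X\<^sub>0) (F {x\<^sub>0})"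
    and "\<forall>x\<in>X\<^sub>0. \<nu>\<^sub>0 (generator \<Sigma> \<Theta> X\<^sub>0 x) = generator \<Sigma> \<Theta> {x\<^sub>0} x\<^sub>0"
    and "is_automorphism (free_category \<Sigma> \<Theta>) \<phi>"
    and "\<forall>A\<in>Obj (free_category \<Sigma> \<Theta>). obj_map \<phi> A = A"
    and "\<forall>\<mu>\<in>homs \<Sigma> (F X\<^sub>0) (F X\<^sub>0). arr_map \<phi> (F X\<^sub>0) (F X\<^sub>0) \<mu> = \<mu>"
    and "arr_map \<phi> (F X\<^sub>0) (F {x\<^sub>0}) \<nu>\<^sub>0 = \<nu>\<^sub>0"
  shows "is_inner_automorphism (free_category \<Sigma> \<Theta>) \<phi>"
proof -
  let ?C = "free_category \<Sigma> \<Theta>"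
  let ?g = "generator \<Sigma> \<Theta> {x\<^sub>0} x\<^sub>0" and ?F\<^sub>0 = "F {x\<^sub>0}" and ?H = "F X\<^sub>0"
  note fix_obj = assms(10) and End_id = assms(11) and \<nu>\<^sub>0_fixed = assms(12)
  have \<Theta>: "is_variety \<Sigma> \<Theta>" using assms(3) by (simp add: is_hereditary_def)
  have Hom: "Hom ?C A B = homs \<Sigma> A B" for A B by (simp add: free_category_def)
  have Comp: "Comp ?C A B D g f = compose (carrier A) g f" for A B D f g
    by (simp add: free_category_def)
  have Obj: "A \<in> \<Theta>" if "A \<in> Obj ?C" for A
    using that free_algebra_in_variety[OF \<Theta>] by (auto simp: free_category_def)
  have alg: "is_algebra \<Sigma> A" if "A \<in> Obj ?C" for A
    using is_variety_is_algebra[OF \<Theta> Obj[OF that]] .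
  have F\<^sub>0: "?F\<^sub>0 \<in> Obj ?C" and H: "?H \<in> Obj ?C"
    using assms(4) by (auto simp: free_category_def F_def)
  have g: "?g \<in> carrier ?F\<^sub>0" unfolding F_def by (rule generator_in_carrier) simp
  have \<phi>_bij: "bij_betw (arr_map \<phi> A B) (homs \<Sigma> A B) (homs \<Sigma> A B)"
    if "A \<in> Obj ?C" "B \<in> Obj ?C" for A B
    using automorphism_bij_betw_Hom[OF assms(9) fix_obj that] by (simp add: Hom)
  have \<phi>_comp: "arr_map \<phi> A D (compose (carrier A) k f) =
      compose (carrier A) (arr_map \<phi> B D k) (arr_map \<phi> A B f)"
    if "A \<in> Obj ?C" "B \<in> Obj ?C" "D \<in> Obj ?C" "f \<in> homs \<Sigma> A B" "k \<in> homs \<Sigma> B D" for A B D f k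
    using assms(9) fix_obj that unfolding is_automorphism_def is_endofunctor_def
    by (simp add: Hom Comp)

  \<comment> \<open>An element \<open>\<nu> x\<^sub>0\<close> of \<open>A\<close>, where \<open>\<nu> : F(x\<^sub>0) \<rightarrow> A\<close>, is sent to \<open>\<phi>(\<nu>) x\<^sub>0\<close>.\<close>
  define pt where "pt A = inv_into (homs \<Sigma> ?F\<^sub>0 A) (\<lambda>h. h ?g)" for A :: "('f, 'v) alg"
  define s where "s A = (\<lambda>a\<in>carrier A. arr_map \<phi> ?F\<^sub>0 A (pt A a) ?g)" for A :: "('f, 'v) alg"
  have cyc: "bij_betw (\<lambda>h. h ?g) (homs \<Sigma> ?F\<^sub>0 A) (carrier A)" if "A \<in> Obj ?C" for A
    unfolding F_def by (rule bij_betw_homs_cyclic[OF \<Theta> Obj[OF that]])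
  have s_eq: "s A (h ?g) = arr_map \<phi> ?F\<^sub>0 A h ?g"
    if A: "A \<in> Obj ?C" and h: "h \<in> homs \<Sigma> ?F\<^sub>0 A" for A h
    using bij_betw_inv_into_left[OF cyc[OF A] h] bij_betwE[OF cyc[OF A]] h by (simp add: s_def pt_def)
  have pt: "pt A a \<in> homs \<Sigma> ?F\<^sub>0 A" "pt A a ?g = a" if "A \<in> Obj ?C" "a \<in> carrier A" for A a
    using bij_betwE[OF bij_betw_inv_into[OF cyc[OF that(1)]]] that
      bij_betw_inv_into_right[OF cyc[OF that(1)] that(2)] by (auto simp: pt_def)
  have s_bij: "bij_betw (s A) (carrier A) (carrier A)" if A: "A \<in> Obj ?C" for A
  proof -
    have "bij_betw ((\<lambda>h. h ?g) \<circ> (arr_map \<phi> ?F\<^sub>0 A \<circ> pt A)) (carrier A) (carrier A)"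
      unfolding pt_def
      by (intro bij_betw_trans[OF bij_betw_trans[OF bij_betw_inv_into[OF cyc[OF A]] \<phi>_bij[OF F\<^sub>0 A]]
            cyc[OF A]])
    then show ?thesis by (rule bij_betw_cong[THEN iffD1, rotated]) (simp add: s_def)
  qed
  have s_carrier: "s A a \<in> carrier A" if "A \<in> Obj ?C" "a \<in> carrier A" for A a
    using bij_betwE[OF s_bij] that by blast

  have natural: "arr_map \<phi> A B \<mu> (s A a) = s B (\<mu> a)"
    if A: "A \<in> Obj ?C" and B: "B \<in> Obj ?C" and \<mu>: "\<mu> \<in> homs \<Sigma> A B" and a: "a \<in> carrier A"
    for A B \<mu> a
  proof -
    note p = pt[OF A a]
    have "s B (\<mu> a) = s B (compose (carrier ?F\<^sub>0) \<mu> (pt A a) ?g)"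
      using g p by (simp add: compose_def)
    also have "\<dots> = arr_map \<phi> ?F\<^sub>0 B (compose (carrier ?F\<^sub>0) \<mu> (pt A a)) ?g"
      by (rule s_eq[OF B homs_compose[OF \<mu> p(1) alg[OF F\<^sub>0]]])
    also have "\<dots> = arr_map \<phi> A B \<mu> (arr_map \<phi> ?F\<^sub>0 A (pt A a) ?g)"
      unfolding \<phi>_comp[OF F\<^sub>0 A B p(1) \<mu>] using g by (simp add: compose_def)
    finally show ?thesis using a by (simp add: s_def)
  qed

  obtain x where x: "x \<in> X\<^sub>0" using assms(5) by auto
  have s_H: "s ?H a = a" if a: "a \<in> carrier ?H" for a
  proof -
    note p = pt[OF H a]
    let ?x = "generator \<Sigma> \<Theta> X\<^sub>0 x"
    have xH: "?x \<in> carrier ?H" unfolding F_def by (rule generator_in_carrier[OF x])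
    \<comment> \<open>Both sides are the image under \<open>\<phi>\<close> of an endomorphism of \<open>F\<^sup>0\<close>; they are compared at \<open>x\<close>,
      which \<open>\<nu>\<^sub>0\<close> maps to the generator of \<open>F(x\<^sub>0)\<close>.\<close>
    have "compose (carrier ?H) (pt ?H a) \<nu>\<^sub>0 = compose (carrier ?H) (arr_map \<phi> ?F\<^sub>0 ?H (pt ?H a)) \<nu>\<^sub>0"
      using \<phi>_comp[OF H F\<^sub>0 H assms(7) p(1)] End_id homs_compose[OF p(1) assms(7) alg[OF H]]
        \<nu>\<^sub>0_fixed by simp
    from fun_cong[OF this, of ?x] have "arr_map \<phi> ?F\<^sub>0 ?H (pt ?H a) ?g = pt ?H a ?g"
      using xH x assms(8) by (simp add: compose_def)
    then show ?thesis using a p by (simp add: s_def)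
  qed

  \<comment> \<open>Since \<open>\<phi>\<close> is surjective on morphisms, the images \<open>\<phi>(\<mu>)\<close> alone separate points.\<close>
  have separate: "c = d"
    if A: "A \<in> Obj ?C" and c: "c \<in> carrier A" and d: "d \<in> carrier A"
      and eq: "\<And>\<mu>. \<mu> \<in> homs \<Sigma> A ?H \<Longrightarrow> arr_map \<phi> A ?H \<mu> c = arr_map \<phi> A ?H \<mu> d" for A c d
  proof -
    obtain X where X: "A = free_algebra \<Sigma> \<Theta> X" using A by (auto simp: free_category_def)
    have "\<mu> c = \<mu> d" if "\<mu> \<in> homs \<Sigma> A ?H" for \<mu>
    proof -
      have "\<mu> \<in> arr_map \<phi> A ?H ` homs \<Sigma> A ?H"
        using bij_betw_imp_surj_on[OF \<phi>_bij[OF A H]] that by simp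
      then obtain \<mu>' where "\<mu>' \<in> homs \<Sigma> A ?H" and "\<mu> = arr_map \<phi> A ?H \<mu>'" by blast
      then show ?thesis using eq by simp
    qed
    then show ?thesis
      using homs_to_generating_algebra_separate[OF \<Theta> assms(6) Obj[OF H]] c d unfolding X by metis
  qed

  have s_hom: "s A \<in> homs \<Sigma> A A" if A: "A \<in> Obj ?C" for A
  proof -
    have "s A (op A f as) = op A f (map (s A) as)"
      if f: "f \<in> symbols \<Sigma>" "length as = arity \<Sigma> f" and as: "as \<in> lists (carrier A)" for f as
    proof (rule separate[OF A])
      have op: "op A f as \<in> carrier A" using alg[OF A] f as by (simp add: is_algebra_def)
      then show "s A (op A f as) \<in> carrier A" by (rule s_carrier[OF A])
      have sas: "map (s A) as \<in> lists (carrier A)" using as s_carrier[OF A] by auto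
      then show "op A f (map (s A) as) \<in> carrier A" using alg[OF A] f by (simp add: is_algebra_def)
      fix \<mu> assume \<mu>: "\<mu> \<in> homs \<Sigma> A ?H"
      have nat: "arr_map \<phi> A ?H \<mu> (s A a) = \<mu> a" if a: "a \<in> carrier A" for a
        unfolding natural[OF A H \<mu> a] by (rule s_H) (use \<mu> a in \<open>auto simp: homs_def\<close>)
      have "arr_map \<phi> A ?H \<mu> \<in> homs \<Sigma> A ?H" using bij_betwE[OF \<phi>_bij[OF A H]] \<mu> by blast
      then have "arr_map \<phi> A ?H \<mu> (op A f (map (s A) as)) =
          op ?H f (map (arr_map \<phi> A ?H \<mu>) (map (s A) as))"
        using f sas unfolding homs_def by simp
      also have "map (arr_map \<phi> A ?H \<mu>) (map (s A) as) = map \<mu> as" using nat as by auto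
      also have "op ?H f (map \<mu> as) = \<mu> (op A f as)" using \<mu> f as unfolding homs_def by simp
      finally show "arr_map \<phi> A ?H \<mu> (s A (op A f as)) = arr_map \<phi> A ?H \<mu> (op A f (map (s A) as))"
        using nat[OF op] by simp
    qed
    moreover have "s A \<in> carrier A \<rightarrow>\<^sub>E carrier A"
      using s_carrier[OF A] by (auto simp: s_def)
    ultimately show ?thesis unfolding homs_def by auto
  qed

  define t where "t A = restrict (inv_into (carrier A) (s A)) (carrier A)" for A :: "('f, 'v) alg"
  have st: "s A (t A a) = a" "t A (s A a) = a" "t A a \<in> carrier A"
    if "A \<in> Obj ?C" "a \<in> carrier A" for A a
    using bij_betw_inv_into_right[OF s_bij] bij_betw_inv_into_left[OF s_bij]
      bij_betwE[OF bij_betw_inv_into[OF s_bij]] s_carrier that by (auto simp: t_def)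
  have "inverse_arrows ?C A (obj_map \<phi> A) (s A) (t A)" if A: "A \<in> Obj ?C" for A
  proof -
    have "t A \<in> homs \<Sigma> A A"
      unfolding t_def by (rule homs_inverse[OF alg[OF A] s_hom[OF A] s_bij[OF A]])
    moreover have "compose (carrier A) (t A) (s A) = restrict id (carrier A)"
      and "compose (carrier A) (s A) (t A) = restrict id (carrier A)"
      using st[OF A] by (auto simp: compose_def intro!: restrict_ext)
    ultimately show ?thesis
      using A fix_obj s_hom[OF A]
      by (simp add: inverse_arrows_def Hom Comp) (simp add: free_category_def)
  qed
  moreover have "arr_map \<phi> A B \<nu> =
      Comp ?C (obj_map \<phi> A) B (obj_map \<phi> B) (s B) (Comp ?C (obj_map \<phi> A) A B \<nu> (t A))"
    if A: "A \<in> Obj ?C" and B: "B \<in> Obj ?C" and \<nu>: "\<nu> \<in> Hom ?C A B" for A B \<nu>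
  proof -
    have \<nu>: "\<nu> \<in> homs \<Sigma> A B" using \<nu> by (simp add: Hom)
    have "arr_map \<phi> A B \<nu> = compose (carrier A) (s B) (compose (carrier A) \<nu> (t A))"
    proof (rule extensionalityI[of _ "carrier A"])
      have "arr_map \<phi> A B \<nu> \<in> homs \<Sigma> A B" using bij_betwE[OF \<phi>_bij[OF A B]] \<nu> by blast
      then show "arr_map \<phi> A B \<nu> \<in> extensional (carrier A)" by (auto simp: homs_def PiE_iff)
      fix a assume a: "a \<in> carrier A"
      show "arr_map \<phi> A B \<nu> a = compose (carrier A) (s B) (compose (carrier A) \<nu> (t A)) a"
        using natural[OF A B \<nu> st(3)[OF A a]] st(1)[OF A a] a by (simp add: compose_def)
    qed (rule compose_extensional)
    then show ?thesis using A B fix_obj by (simp add: Comp)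
  qed
  ultimately show ?thesis
    using assms(9) unfolding is_inner_automorphism_def by blast
qed

end
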